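(* Let $d\ge1$, $\ell_1,\ldots,\ell_d>0$, $\alpha_1,\ldots,\alpha_d>0$ and $\mathcal{N}=(N_1,\ldots,N_d)$ with integers $N_i\ge1$. For $i=1,\ldots,d$, let $x_{i,1}^{\mathrm{GH}},\ldots,x_{i,N_i}^{\mathrm{GH}}$ and $w_{i,1}^{\mathrm{GH}},\ldots,w_{i,N_i}^{\mathrm{GH}}$ be the nodes and weights of the $N_i$-point Gauss--Hermite quadrature rule and define the nodes $$\tilde{x}_{i,n}=\frac1{\sqrt2\,\alpha_i\beta_i}x_{i,n}^{\mathrm{GH}},\qquad n=1,\ldots,N_i.$$ For a multi-index $\mathcal{I}$ with $1\le\mathcal{I}(i)\le N_i$ for all $i$, let $\tilde{x}_{\mathcal{I}}=(\tilde{x}_{1,\mathcal{I}(1)},\ldots,\tilde{x}_{d,\mathcal{I}(d)})\in\mathbb{R}^d$. Then the weights of the tensor product rule $$\widetilde{Q}_k^d(f)=\sum_{\mathcal{I}:\,1\le\mathcal{I}(i)\le N_i}\widetilde{w}_{k,\mathcal{I}}\,f(\tilde{x}_{\mathcal{I}}),$$ defined by the exactness conditions $\widetilde{Q}_k^d(\varphi_{\mathcal{J}})=\mu^d(\varphi_{\mathcal{J}})$ for every multi-index $\mathcal{J}$ with $0\le\mathcal{J}(i)\le N_i-1$, $i=1,\ldots,d$, are $\widetilde{w}_{k,\mathcal{I}}=\prod_{i=1}^d\widetilde{w}_{k,\mathcal{I}(i)}^i$, where $$\widetilde{w}_{k,n}^i=\Big(\frac1{1+2\delta_i^2}\Bi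g)^{1/2}w_{i,n}^{\mathrm{GH}}\,e^{\delta_i^2\tilde{x}_{i,n}^2}\sum_{m=0}^{\lfloor(N_i-1)/2\rfloor}\frac1{2^mm!}\Big(\frac{2\alpha_i^2\beta_i^2}{1+2\delta_i^2}-1\Big)^m\mathrm{H}_{2m}(x_{i,n}^{\mathrm{GH}}).$$
   Context: $\mu$ is the standard Gaussian measure on $\mathbb{R}$, $\mu^d$ is the standard Gaussian measure on $\mathbb{R}^d$ (density $(2\pi)^{-d/2}e^{-\|x\|^2/2}$), and $\mu^d(f)=\int f\,\mathrm{d}\mu^d$. $\mathrm{H}_n(x)=(-1)^ne^{x^2/2}\frac{\mathrm{d}^n}{\mathrm{d}x^n}e^{-x^2/2}$ are the probabilists' Hermite polynomials. The $N$-point Gauss--Hermite rule is the unique $N$-point quadrature rule that integrates all polynomials of degree at most $2N-1$ exactly with respect to $\mu$; its nodes are the roots of $\mathrm{H}_N$. For each $i=1,\ldots,d$ (with $\ell_i$ the length-scale of the one-dimensional Gaussian kernel $k_i(x,y)=\exp(-(x-y)^2/(2\ell_i^2))$), set $$\epsilon_i=\frac1{\sqrt2\,\ell_i},\qquad \beta_i=\Big(1+\Big(\frac{2\epsilon_i}{\alpha_i}\Big)^2\Big)^{1/4},\qquad \delta_i^2=\frac{\alpha_i^2}{2}(\beta_i^2-1),$$ $$\varphi_{n}^{\alpha_i}(x)=\sqrt{\frac{\beta_i}{n!}}\,e^{-\delta_i^2x^2}\mathrm{H}_n(\sqrt2\,\alpha_i\beta_ix)\quad(n\ge0,\ x\in\mathbb{R}),$$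 where $\varphi_n^{\alpha_i}$ depends on both $\alpha_i$ and $\ell_i$. For $x\in\mathbb{R}^d$ and a multi-index $\mathcal{J}$ of non-negative integers, $\varphi_{\mathcal{J}}(x)=\prod_{i=1}^d\varphi_{\mathcal{J}(i)}^{\alpha_i}(x_i)$. The convention $0^0=1$ is used. *)

theory Defs
  imports "HOL-Analysis.Analysis" "HOL-Computational_Algebra.Polynomial"
begin

text \<open>This covers both the measure on the real line (type \<^typ>\<open>real\<close>, of dimension 1) and the
  one on d-dimensional space (type \<open>real ^ 'd\<close>).\<close>

definition std_gaussian :: "'a::euclidean_space measure" where
  "std_gaussian = density lborel
     (\<lambda>x. ennreal ((2 * pi) powr (- (real DIM('a) / 2)) * exp (- (norm x)\<^sup>2 / 2)))"

definition hermite :: "nat \<Rightarrow> real \<Rightarrow> real" where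
  "hermite n x = (-1) ^ n * exp (x\<^sup>2 / 2) * (deriv ^^ n) (\<lambda>t. exp (- t\<^sup>2 / 2)) x"

text \<open>Nodes and weights are indexed by 1, ..., N, in any order; their values at other indices
  are irrelevant. That the nodes are the roots of the Hermite polynomial of degree N is a
  consequence and not part of the definition.\<close>

definition gauss_hermite_rule :: "nat \<Rightarrow> (nat \<Rightarrow> real) \<Rightarrow> (nat \<Rightarrow> real) \<Rightarrow> bool" where
  "gauss_hermite_rule N x w \<longleftrightarrow>
     inj_on x {1..N} \<and>
     (\<forall>p :: real poly. degree p \<le> 2 * N - 1 \<longrightarrow>
        (\<Sum>n=1..N. w n * poly p (x n)) = (\<integral>t. poly p t \<partial>std_gaussian))"

text \<open>In the following the arguments are the length-scale \<open>l\<close> and the parameter \<open>\<alpha>\<close> of a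
  single coordinate; \<open>delta_sq\<close> is the square of the constant usually written \<open>\<delta>\<close>.\<close>

definition eps :: "real \<Rightarrow> real" where
  "eps l = 1 / (sqrt 2 * l)"

definition beta :: "real \<Rightarrow> real \<Rightarrow> real" where
  "beta l \<alpha> = (1 + (2 * eps l / \<alpha>)\<^sup>2) powr (1 / 4)"

definition delta_sq :: "real \<Rightarrow> real \<Rightarrow> real" where
  "delta_sq l \<alpha> = \<alpha>\<^sup>2 / 2 * ((beta l \<alpha>)\<^sup>2 - 1)"

definition phi :: "real \<Rightarrow> real \<Rightarrow> nat \<Rightarrow> real \<Rightarrow> real" where
  "phi l \<alpha> n x = sqrt (beta l \<alpha> / fact n) * exp (- delta_sq l \<alpha> * x\<^sup>2)
     * hermite n (sqrt 2 * \<alpha> * beta l \<alpha> * x)"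

definition phi_multi ::
  "('d::finite \<Rightarrow> real) \<Rightarrow> ('d \<Rightarrow> real) \<Rightarrow> ('d \<Rightarrow> nat) \<Rightarrow> real ^ 'd \<Rightarrow> real" where
  "phi_multi l \<alpha> J x = (\<Prod>i\<in>UNIV. phi (l i) (\<alpha> i) (J i) (x $ i))"

definition scaled_node :: "real \<Rightarrow> real \<Rightarrow> real \<Rightarrow> real" where
  "scaled_node l \<alpha> x = x / (sqrt 2 * \<alpha> * beta l \<alpha>)"

definition tensor_node ::
  "('d::finite \<Rightarrow> real) \<Rightarrow> ('d \<Rightarrow> real) \<Rightarrow> ('d \<Rightarrow> nat \<Rightarrow> real) \<Rightarrow> ('d \<Rightarrow> nat) \<Rightarrow> real ^ 'd" where
  "tensor_node l \<alpha> x I = (\<chi> i. scaled_node (l i) (\<alpha> i) (x i (I i)))"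

definition node_indices :: "('d::finite \<Rightarrow> nat) \<Rightarrow> ('d \<Rightarrow> nat) set" where
  "node_indices N = {I. \<forall>i. 1 \<le> I i \<and> I i \<le> N i}"

definition tensor_rule ::
  "('d::finite \<Rightarrow> real) \<Rightarrow> ('d \<Rightarrow> real) \<Rightarrow> ('d \<Rightarrow> nat) \<Rightarrow> ('d \<Rightarrow> nat \<Rightarrow> real) \<Rightarrow>
   (('d \<Rightarrow> nat) \<Rightarrow> real) \<Rightarrow> (real ^ 'd \<Rightarrow> real) \<Rightarrow> real" where
  "tensor_rule l \<alpha> N x W f = (\<Sum>I\<in>node_indices N. W I * f (tensor_node l \<alpha> x I))"

text \<open>The last two arguments are a node and the corresponding weight of the \<open>N\<close>-point
  Gauss-Hermite rule. The power with exponent \<open>m = 0\<close> is 1 also when its base is 0.\<close>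

definition kernel_weight :: "real \<Rightarrow> real \<Rightarrow> nat \<Rightarrow> real \<Rightarrow> real \<Rightarrow> real" where
  "kernel_weight l \<alpha> N x w =
     sqrt (1 / (1 + 2 * delta_sq l \<alpha>)) * w * exp (delta_sq l \<alpha> * (scaled_node l \<alpha> x)\<^sup>2)
     * (\<Sum>m=0..(N - 1) div 2.
          1 / (2 ^ m * fact m) * (2 * \<alpha>\<^sup>2 * (beta l \<alpha>)\<^sup>2 / (1 + 2 * delta_sq l \<alpha>) - 1) ^ m
          * hermite (2 * m) x)"

end

theory Submission
  imports Defs "HOL-Probability.Distributions"
begin

text \<open>In one dimension, the exponential factors of \<open>\<phi>\<^sub>j\<close> and of the weights cancel at the
  nodes, and exactness of the Gauss-Hermite rule turns the discrete sums of \<open>H\<^sub>2\<^sub>m H\<^sub>j\<close> into Gaussian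
  integrals, so that orthogonality leaves a single term. On the other side, rescaling \<open>t\<close> absorbs
  \<open>exp (- \<delta>\<^sup>2 t\<^sup>2)\<close> into the Gaussian density, leaving the integral of \<open>H\<^sub>j (c t)\<close>, which integration by
  parts evaluates through \<open>E (H\<^bsub>n+2\<^esub> (c t)) = (n + 1) (c\<^sup>2 - 1) E (H\<^sub>n (c t))\<close>. Both the rule and the
  integral factor over the coordinates, and products of one-dimensional dual bases show that the
  exactness conditions determine the weights.\<close>

section \<open>Gaussian integrals of polynomials\<close>

lemma std_gaussian_real: "(std_gaussian :: real measure) = density lborel std_normal_density"
  unfolding std_gaussian_def
  by (rule arg_cong[where f = "density lborel"])
     (simp add: fun_eq_iff std_normal_density_def powr_minus powr_half_sqrt field_simps)

lemma has_bochner_integral_std_gaussian_real: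
  fixes f :: "real \<Rightarrow> real"
  assumes "f \<in> borel_measurable borel"
    and "has_bochner_integral lborel (\<lambda>t. std_normal_density t * f t) c"
  shows "has_bochner_integral std_gaussian f c"
  unfolding std_gaussian_real
  by (rule has_bochner_integral_density) (use assms in auto)

lemma integrable_std_gaussian_power: "integrable std_gaussian (\<lambda>t::real. t ^ k)"
  using has_bochner_integral_std_gaussian_real[OF _
      has_bochner_integral_integrable[OF integrable_std_normal_moment[of k]]]
  by (auto intro: has_bochner_integral_integrable integrable.intros)

lemma borel_measurable_poly [measurable]:
  "(poly p :: real \<Rightarrow> real) \<in> borel_measurable borel"
  by (intro borel_measurable_continuous_onI continuous_intros)

lemma integrable_std_gaussian_poly [simp]: "integrable std_gaussian (poly p :: real \<Rightarrow> real)"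
proof -
  have "integrable std_gaussian (\<lambda>t::real. \<Sum>i\<le>degree p. coeff p i * t ^ i)"
    by (intro Bochner_Integration.integrable_sum integrable_mult_right
        integrable_std_gaussian_power)
  then show ?thesis
    by (simp add: poly_altdef[abs_def])
qed

text \<open>A polynomial argument makes linearity unconditional, since every polynomial is
  integrable, and turns integration by parts into an identity about \<open>pderiv\<close>.\<close>

definition gauss_expect :: "real poly \<Rightarrow> real" where
  "gauss_expect p = (\<integral>t. poly p t \<partial>std_gaussian)"

lemma gauss_expect_add: "gauss_expect (p + q) = gauss_expect p + gauss_expect q"
  by (simp add: gauss_expect_def)

lemma gauss_expect_diff: "gauss_expect (p - q) = gauss_expect p - gauss_expect q"
  by (simp add: gauss_expect_def)

lemma gauss_expect_smult: "gauss_expect (smult c p) = c * gauss_expect p"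
  by (simp add: gauss_expect_def)

lemma gauss_expect_0 [simp]: "gauss_expect 0 = 0"
  by (simp add: gauss_expect_def)

lemma gauss_expect_even_moment: "gauss_expect (monom 1 (2 * k)) = fact (2 * k) / (2 ^ k * fact k)"
  using has_bochner_integral_std_gaussian_real[OF _ std_normal_moment_even[of k]]
  by (simp add: gauss_expect_def poly_monom has_bochner_integral_integral_eq)

lemma gauss_expect_odd_moment: "gauss_expect (monom 1 (2 * k + 1)) = 0"
  using has_bochner_integral_std_gaussian_real[OF _ std_normal_moment_odd[of k]]
  by (simp add: gauss_expect_def poly_monom has_bochner_integral_integral_eq)

lemma gauss_expect_1 [simp]: "gauss_expect 1 = 1"
  using gauss_expect_even_moment[of 0] by simp

text \<open>The moment recursion, read off from the closed forms of the moments: odd moments vanish,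
  and consecutive even ones differ by an odd factor.\<close>

lemma gauss_expect_monom_step:
  "gauss_expect (monom 1 (Suc k)) = gauss_expect (pderiv (monom 1 k))"
proof (cases k)
  case 0
  then show ?thesis
    using gauss_expect_odd_moment[of 0] by (simp add: pderiv_monom)
next
  case (Suc j)
  have m: "pderiv (monom 1 k) = smult (real k) (monom 1 j)"
    using Suc by (simp add: pderiv_monom smult_monom)
  show ?thesis
  proof (cases "even j")
    case True
    then obtain i where i: "j = 2 * i" by blast
    have "gauss_expect (monom 1 (Suc k)) = gauss_expect (monom 1 (2 * Suc i))"
      using Suc i by simp
    also have "\<dots> = real k * gauss_expect (monom 1 (2 * i))"
    proof -
      \<comment> \<open>Here \<open>k = 2 * i + 1\<close>. Both factorials are written with the
        common factor \<open>2 * (i + 1)\<close>, so that it cancels in the quotient.\<close>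
      have num: "(fact (2 * Suc i) :: real) = (2 * real (Suc i)) * (real k * fact (2 * i))"
        using Suc i by (simp add: algebra_simps)
      have den: "(2 ^ Suc i * fact (Suc i) :: real) = (2 * real (Suc i)) * (2 ^ i * fact i)"
        by simp
      show ?thesis
        unfolding gauss_expect_even_moment num den
        by (subst mult_divide_mult_cancel_left) simp_all
    qed
    finally show ?thesis
      by (simp add: m gauss_expect_smult i)
  next
    case False
    then obtain i where i: "j = 2 * i + 1" by (auto elim: oddE)
    have "gauss_expect (monom 1 (Suc k)) = gauss_expect (monom 1 (2 * Suc i + 1))"
      using Suc i by simp
    then show ?thesis
      unfolding m gauss_expect_smult i gauss_expect_odd_moment by simp
  qed
qed

text \<open>The monomial factor makes induction over the coefficients of \<open>p\<close> possible:
  the tail of \<open>pCons a q\<close> is multiplied by the variable, which raises \<open>k\<close>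
  by one and leaves only the moment recursion for the constant term.\<close>

lemma gauss_expect_by_parts_monom:
  "gauss_expect (monom 1 (Suc k) * p) = gauss_expect (pderiv (monom 1 k * p))"
proof (induction p arbitrary: k)
  case 0
  then show ?case by simp
next
  case (pCons a q)
  have shift: "monom 1 j * pCons a q = smult a (monom 1 j) + monom 1 (Suc j) * q" for j
    by (simp add: monom_Suc algebra_simps)
  show ?case
    unfolding shift pderiv_add pderiv_smult gauss_expect_add gauss_expect_smult
    using pCons.IH[of "Suc k"] gauss_expect_monom_step[of k] by simp
qed

lemma gauss_expect_by_parts: "gauss_expect ([:0, 1:] * p) = gauss_expect (pderiv p)"
  using gauss_expect_by_parts_monom[of 0 p] by (simp add: monom_Suc)


section \<open>Hermite polynomials\<close>

text \<open>The recursion is the product rule for \<open>exp (- t\<^sup>2 / 2)\<close> times a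
  polynomial, with the sign removed; it gives the analytic \<open>hermite\<close> an algebraic
  counterpart.\<close>

fun hermite_poly :: "nat \<Rightarrow> real poly" where
  "hermite_poly 0 = 1"
| "hermite_poly (Suc n) = [:0, 1:] * hermite_poly n - pderiv (hermite_poly n)"

lemma deriv_iterate_gaussian:
  "(deriv ^^ n) (\<lambda>t. exp (- t\<^sup>2 / 2)) =
     (\<lambda>t::real. (-1) ^ n * exp (- t\<^sup>2 / 2) * poly (hermite_poly n) t)"
proof (induction n)
  case 0
  then show ?case by simp
next
  case (Suc n)
  have "deriv (\<lambda>t::real. (-1) ^ n * exp (- t\<^sup>2 / 2) * poly (hermite_poly n) t) t =
          (-1) ^ Suc n * exp (- t\<^sup>2 / 2) * poly (hermite_poly (Suc n)) t" for t
    by (rule DERIV_imp_deriv)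
       (auto intro!: derivative_eq_intros poly_DERIV simp: field_simps)
  then show ?case
    by (simp only: funpow.simps comp_def Suc.IH)
qed

lemma hermite_eq_poly: "hermite n x = poly (hermite_poly n) x"
proof -
  have "hermite n x = ((-1) ^ n * (-1) ^ n) * (exp (x\<^sup>2 / 2) * exp (- x\<^sup>2 / 2)) *
      poly (hermite_poly n) x"
    unfolding hermite_def deriv_iterate_gaussian by (simp only: mult_ac)
  then show ?thesis
    by (simp flip: exp_add)
qed

text \<open>The Appell property. Differentiating the recursion once and inserting the induction
  hypothesis reproduces the same recursion one index lower, multiplied by
  \<open>n + 1\<close>.\<close>

lemma pderiv_hermite_poly: "pderiv (hermite_poly (Suc n)) = smult (real (Suc n)) (hermite_poly n)"
proof (induction n)
  case 0
  then show ?case by (simp add: pderiv_pCons)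
next
  case (Suc n)
  have "pderiv (hermite_poly (Suc (Suc n))) =
      hermite_poly (Suc n) + [:0, 1:] * pderiv (hermite_poly (Suc n))
        - pderiv (pderiv (hermite_poly (Suc n)))"
    by (subst (1) hermite_poly.simps(2)) (simp only: pderiv_diff pderiv_mult, simp add: pderiv_pCons)
  also have "\<dots> = hermite_poly (Suc n) + smult (real (Suc n)) (hermite_poly (Suc n))"
    by (simp only: Suc.IH pderiv_smult) (simp add: smult_diff_right)
  also have "\<dots> = smult (real (Suc (Suc n))) (hermite_poly (Suc n))"
    using smult_add_left[of 1 "real (Suc n)" "hermite_poly (Suc n)"]
    by (simp del: hermite_poly.simps add: add.commute)
  finally show ?case .
qed

lemma degree_hermite_poly_le: "degree (hermite_poly n) \<le> n"
proof (induction n)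
  case 0
  then show ?case by simp
next
  case (Suc n)
  have "degree ([:0, 1:] * hermite_poly n) \<le> Suc n"
    using Suc degree_pCons_le[of 0 "hermite_poly n"] by simp
  moreover have "degree (pderiv (hermite_poly n)) \<le> Suc n"
    using Suc by (simp add: degree_pderiv)
  ultimately show ?case
    by (simp add: degree_diff_le)
qed

lemma coeff_hermite_poly [simp]: "coeff (hermite_poly n) n = 1"
proof (induction n)
  case 0
  then show ?case by simp
next
  case (Suc n)
  then show ?case
    using degree_hermite_poly_le[of n] by (simp add: coeff_pderiv coeff_eq_0)
qed

text \<open>Each Hermite polynomial is monic of the degree given by its index, so subtracting a
  multiple of it removes the leading term.\<close>

lemma hermite_poly_basis:
  assumes "degree p < n"
  shows "\<exists>c. p = (\<Sum>j<n. smult (c j) (hermite_poly j))"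
  using assms
proof (induction n arbitrary: p)
  case 0
  then show ?case by simp
next
  case (Suc n)
  define q where "q = p - smult (coeff p n) (hermite_poly n)"
  have p: "p = q + smult (coeff p n) (hermite_poly n)"
    by (simp add: q_def)
  have "degree q \<le> n"
    unfolding q_def using Suc.prems degree_hermite_poly_le[of n]
    by (intro degree_diff_le) (auto intro: order_trans[OF degree_smult_le])
  moreover have "coeff q n = 0"
    by (simp add: q_def)
  \<comment> \<open>The zero polynomial also has degree 0, so for \<open>n = 0\<close> the remainder
    cannot satisfy the strict bound and needs its own case.\<close>
  ultimately consider "q = 0" | "degree q < n"
    by (metis eq_zero_or_degree_less)
  then obtain c where c: "q = (\<Sum>j<n. smult (c j) (hermite_poly j))"
  proof cases
    case 1
    then show ?thesis using that[of "\<lambda>_. 0"] by simp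
  next
    case 2
    then show ?thesis using Suc.IH that by blast
  qed
  have "p = (\<Sum>j<Suc n. smult ((c(n := coeff p n)) j) (hermite_poly j))"
    by (subst p) (simp add: c)
  then show ?case by blast
qed

text \<open>Raising the Hermite index is adjoint to differentiation: after integration by parts, the
  term with the derivative of \<open>hermite_poly n\<close> cancels against the recursion.\<close>

lemma gauss_expect_hermite_Suc:
  "gauss_expect (hermite_poly (Suc n) * p) = gauss_expect (hermite_poly n * pderiv p)"
  using gauss_expect_by_parts[of "hermite_poly n * p"]
  by (simp add: pderiv_mult left_diff_distrib gauss_expect_add gauss_expect_diff mult.assoc)
     (simp add: mult.commute)

text \<open>Adjointness and the Appell property lower both indices together, each time with a factor
  of the larger \<open>n\<close>, until one index is 0; a constant left on the other side is then
  differentiated away unless both reach 0.\<close>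

lemma gauss_expect_hermite_hermite:
  "gauss_expect (hermite_poly m * hermite_poly n) = (if m = n then fact m else 0)"
proof (induction m arbitrary: n)
  case 0
  then show ?case
    using gauss_expect_hermite_Suc[of _ 1]
    by (cases n) (simp_all del: hermite_poly.simps(2))
next
  case (Suc m)
  then show ?case
    by (cases n)
       (simp_all only: gauss_expect_hermite_Suc pderiv_hermite_poly mult_smult_right
         gauss_expect_smult hermite_poly.simps(1), auto)
qed

text \<open>The term \<open>c\<^sup>2\<close> has one factor \<open>c\<close> from the variable in
  the recursion and one from the chain rule after integration by parts; the term \<open>- 1\<close>
  is the derivative term of the recursion.\<close>

lemma gauss_expect_scaled_hermite_Suc_Suc:
  "gauss_expect (hermite_poly (Suc (Suc n)) \<circ>\<^sub>p [:0, c:]) =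
     real (Suc n) * (c\<^sup>2 - 1) * gauss_expect (hermite_poly n \<circ>\<^sub>p [:0, c:])"
proof -
  have "hermite_poly (Suc (Suc n)) \<circ>\<^sub>p [:0, c:] =
      smult c ([:0, 1:] * (hermite_poly (Suc n) \<circ>\<^sub>p [:0, c:]))
        - smult (real (Suc n)) (hermite_poly n \<circ>\<^sub>p [:0, c:])"
    unfolding hermite_poly.simps(2)[of "Suc n"] pderiv_hermite_poly
    by (simp only: pcompose_diff pcompose_mult pcompose_smult) (simp add: pcompose_pCons)
  then have "gauss_expect (hermite_poly (Suc (Suc n)) \<circ>\<^sub>p [:0, c:]) =
      c * gauss_expect (pderiv (hermite_poly (Suc n) \<circ>\<^sub>p [:0, c:]))
        - real (Suc n) * gauss_expect (hermite_poly n \<circ>\<^sub>p [:0, c:])"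
    by (simp only: gauss_expect_diff gauss_expect_smult gauss_expect_by_parts)
  also have "pderiv (hermite_poly (Suc n) \<circ>\<^sub>p [:0, c:]) =
      smult (c * real (Suc n)) (hermite_poly n \<circ>\<^sub>p [:0, c:])"
    by (simp only: pderiv_pcompose pderiv_hermite_poly pcompose_smult) (simp add: pderiv_pCons)
  finally show ?thesis
    by (simp only: gauss_expect_smult) (simp add: algebra_simps power2_eq_square)
qed

text \<open>The factor \<open>fact (2 * m)\<close> is kept apart because orthogonality produces it
  on the discrete side; what remains has the shape of the coefficients in
  \<open>kernel_weight\<close>.\<close>

lemma gauss_expect_scaled_hermite:
  "gauss_expect (hermite_poly (2 * m) \<circ>\<^sub>p [:0, c:]) =
     fact (2 * m) * (1 / (2 ^ m * fact m) * (c\<^sup>2 - 1) ^ m)"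
  "gauss_expect (hermite_poly (2 * m + 1) \<circ>\<^sub>p [:0, c:]) = 0"
proof (induction m)
  case 0
  {
    case 1
    then show ?case by (simp add: pcompose_1)
  next
    case 2
    then show ?case
      using gauss_expect_by_parts[of "[:c:]"] by (simp add: pcompose_pCons)
  }
next
  case (Suc m)
  {
    case 1
    have "gauss_expect (hermite_poly (2 * Suc m) \<circ>\<^sub>p [:0, c:]) =
        real (Suc (2 * m)) * (c\<^sup>2 - 1) * gauss_expect (hermite_poly (2 * m) \<circ>\<^sub>p [:0, c:])"
      using gauss_expect_scaled_hermite_Suc_Suc[of "2 * m" c] by (simp del: hermite_poly.simps)
    also have "\<dots> = fact (2 * Suc m) * (1 / (2 ^ Suc m * fact (Suc m)) * (c\<^sup>2 - 1) ^ Suc m)"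
    proof -
      have num: "(fact (2 * Suc m) :: real) = (2 * real (Suc m)) * (real (Suc (2 * m)) * fact (2 * m))"
        by (simp add: algebra_simps)
      have den: "(2 ^ Suc m * fact (Suc m) :: real) = (2 * real (Suc m)) * (2 ^ m * fact m)"
        by simp
      show ?thesis
        unfolding Suc(1) num den by (simp del: of_nat_Suc add: field_simps)
    qed
    finally show ?case .
  next
    case 2
    show ?case
      using gauss_expect_scaled_hermite_Suc_Suc[of "2 * m + 1" c] Suc(2)
      by (simp del: hermite_poly.simps)
  }
qed


section \<open>The one-dimensional rule\<close>

text \<open>Substituting \<open>s * t\<close> with \<open>s\<^sup>2 = 1 / (1 + 2 * d)\<close> turns
  the combined exponent back into that of the standard density; the outer factor is the
  Jacobian.\<close>

lemma gaussian_exp_poly: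
  fixes d :: real
  assumes "d \<ge> 0"
  shows "has_bochner_integral std_gaussian (\<lambda>t. exp (- d * t\<^sup>2) * poly p t)
           (sqrt (1 / (1 + 2 * d)) * gauss_expect (p \<circ>\<^sub>p [:0, sqrt (1 / (1 + 2 * d)):]))"
proof (rule has_bochner_integral_std_gaussian_real)
  define s where "s = sqrt (1 / (1 + 2 * d))"
  have s: "s > 0" "s\<^sup>2 = 1 / (1 + 2 * d)"
    using assms by (auto simp: s_def)
  let ?q = "p \<circ>\<^sub>p [:0, s:]"
  \<comment> \<open>The form \<open>0 + s * t\<close> matches the affine change of variables applied
    at the end.\<close>
  have dens: "std_normal_density (0 + s * t) * (exp (- d * (0 + s * t)\<^sup>2) * poly p (0 + s * t)) =
      std_normal_density t * poly ?q t" for t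
  proof -
    have "- (s * t)\<^sup>2 / 2 - d * (s * t)\<^sup>2 = - t\<^sup>2 / 2"
      unfolding power_mult_distrib s(2) using assms by (simp add: divide_simps) (simp add: algebra_simps)
    then have "exp (- (s * t)\<^sup>2 / 2) * exp (- d * (s * t)\<^sup>2) = exp (- t\<^sup>2 / 2)"
      by (simp flip: exp_add)
    then show ?thesis
      by (simp add: std_normal_density_def poly_pcompose mult.commute[of t s])
  qed
  have "integrable lborel (\<lambda>t. std_normal_density t * poly ?q t)"
    using integrable_std_gaussian_poly[of ?q] unfolding std_gaussian_real
    by (subst (asm) integrable_density) auto
  moreover have "gauss_expect ?q = (\<integral>t. std_normal_density t * poly ?q t \<partial>lborel)"
    unfolding gauss_expect_def std_gaussian_real by (subst integral_density) auto
  ultimately have "has_bochner_integral lborel (\<lambda>t. std_normal_density t * poly ?q t) (gauss_expect ?q)"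
    by (simp add: has_bochner_integral_iff)
  moreover have "(s * gauss_expect ?q) /\<^sub>R \<bar>s\<bar> = gauss_expect ?q"
    using s(1) by simp
  ultimately show "has_bochner_integral lborel
      (\<lambda>t. std_normal_density t * (exp (- d * t\<^sup>2) * poly p t))
      (sqrt (1 / (1 + 2 * d)) * gauss_expect (p \<circ>\<^sub>p [:0, sqrt (1 / (1 + 2 * d)):]))"
    unfolding s_def[symmetric]
    by (subst lborel_has_bochner_integral_real_affine_iff[where c = s and t = 0])
       (use s(1) in \<open>simp_all only: dens less_imp_neq[symmetric] not_False_eq_True\<close>)
qed simp

section \<open>Integrals and node values of the functions \<open>phi\<close>\<close>

lemma beta_ge_1: "beta l \<alpha> \<ge> 1"
  unfolding beta_def by (rule ge_one_powr_ge_zero) auto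

lemma delta_sq_nonneg: "delta_sq l \<alpha> \<ge> 0"
  using beta_ge_1[of l \<alpha>] by (simp add: delta_sq_def)

lemma phi_eq_exp_poly:
  "phi l \<alpha> j = (\<lambda>t. sqrt (beta l \<alpha> / fact j) * (exp (- delta_sq l \<alpha> * t\<^sup>2) *
     poly (hermite_poly j \<circ>\<^sub>p [:0, sqrt 2 * \<alpha> * beta l \<alpha>:]) t))"
  by (simp add: phi_def hermite_eq_poly poly_pcompose fun_eq_iff mult_ac)

text \<open>The scaling inside \<open>phi\<close> and the one from the Gaussian substitution compose
  to a single factor, whose square minus 1 is the base of the power in
  \<open>kernel_weight\<close>.\<close>

lemma has_bochner_integral_phi:
  "has_bochner_integral std_gaussian (phi l \<alpha> j)
     (sqrt (beta l \<alpha> / fact j) * (sqrt (1 / (1 + 2 * delta_sq l \<alpha>)) *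
        gauss_expect (hermite_poly j \<circ>\<^sub>p
          [:0, sqrt 2 * \<alpha> * beta l \<alpha> * sqrt (1 / (1 + 2 * delta_sq l \<alpha>)):])))"
proof -
  have "(p \<circ>\<^sub>p [:0, a:]) \<circ>\<^sub>p [:0, b:] = p \<circ>\<^sub>p [:0, a * b:]" for p :: "real poly" and a b
    by (simp add: pcompose_pCons mult.commute flip: pcompose_assoc)
  then show ?thesis
    unfolding phi_eq_exp_poly
    using has_bochner_integral_mult_right[OF
        gaussian_exp_poly[OF delta_sq_nonneg[of l \<alpha>],
          of "hermite_poly j \<circ>\<^sub>p [:0, sqrt 2 * \<alpha> * beta l \<alpha>:]"]]
    by simp
qed

lemma phi_scaled_node:
  assumes "\<alpha> > 0"
  shows "phi l \<alpha> j (scaled_node l \<alpha> y) =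
    sqrt (beta l \<alpha> / fact j) * exp (- delta_sq l \<alpha> * (scaled_node l \<alpha> y)\<^sup>2) *
      poly (hermite_poly j) y"
proof -
  have "sqrt 2 * \<alpha> * beta l \<alpha> \<noteq> 0"
    using assms beta_ge_1[of l \<alpha>] by simp
  then show ?thesis
    by (simp add: phi_def hermite_eq_poly scaled_node_def)
qed

section \<open>Discrete orthogonality and exactness of the one-dimensional weights\<close>

lemma gauss_hermite_rule_expect:
  assumes "gauss_hermite_rule N x w" "degree p \<le> 2 * N - 1"
  shows "(\<Sum>n=1..N. w n * poly p (x n)) = gauss_expect p"
  using assms unfolding gauss_hermite_rule_def gauss_expect_def by blast

lemma gauss_hermite_rule_hermite:
  assumes "gauss_hermite_rule N x w" "i < N" "j < N"
  shows "(\<Sum>n=1..N. w n * (poly (hermite_poly i) (x n) * poly (hermite_poly j) (x n))) =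
           (if i = j then fact i else 0)"
proof -
  \<comment> \<open>Both indices are below \<open>N\<close>, so the product has degree at most
    \<open>2 * N - 2\<close>, within the range of exactness.\<close>
  have "degree (hermite_poly i * hermite_poly j) \<le> 2 * N - 1"
    using degree_mult_le[of "hermite_poly i" "hermite_poly j"]
      degree_hermite_poly_le[of i] degree_hermite_poly_le[of j] assms(2,3) by linarith
  from gauss_hermite_rule_expect[OF assms(1) this] show ?thesis
    by (simp add: gauss_expect_hermite_hermite)
qed

lemma kernel_weight_exact:
  assumes "\<alpha> > 0" "gauss_hermite_rule N x w" "j < N"
  shows "(\<Sum>n=1..N. kernel_weight l \<alpha> N (x n) (w n) * phi l \<alpha> j (scaled_node l \<alpha> (x n))) =
           (\<integral>t. phi l \<alpha> j t \<partial>std_gaussian)"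
proof -
  define b where "b = sqrt (beta l \<alpha> / fact j)"
  define s where "s = sqrt (1 / (1 + 2 * delta_sq l \<alpha>))"
  define c where "c m = 1 / (2 ^ m * fact m) *
    (2 * \<alpha>\<^sup>2 * (beta l \<alpha>)\<^sup>2 / (1 + 2 * delta_sq l \<alpha>) - 1) ^ m" for m
  define M where "M = (N - 1) div 2"
  let ?H = "\<lambda>i n. poly (hermite_poly i) (x n)"
  have s2: "(sqrt 2 * \<alpha> * beta l \<alpha> * s)\<^sup>2 = 2 * \<alpha>\<^sup>2 * (beta l \<alpha>)\<^sup>2 / (1 + 2 * delta_sq l \<alpha>)"
    using delta_sq_nonneg[of l \<alpha>] by (simp add: power_mult_distrib s_def)
  have term_eq: "kernel_weight l \<alpha> N (x n) (w n) * phi l \<alpha> j (scaled_node l \<alpha> (x n)) =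
      (\<Sum>m=0..M. b * s * c m * (w n * (?H (2 * m) n * ?H j n)))" for n
  proof -
    define z where "z = delta_sq l \<alpha> * (scaled_node l \<alpha> (x n))\<^sup>2"
    have "kernel_weight l \<alpha> N (x n) (w n) * phi l \<alpha> j (scaled_node l \<alpha> (x n)) =
        (exp z * exp (- z)) * (s * w n * (\<Sum>m=0..M. c m * ?H (2 * m) n) * (b * ?H j n))"
      unfolding phi_scaled_node[OF assms(1)] kernel_weight_def hermite_eq_poly mult_minus_left
        b_def[symmetric] s_def[symmetric] c_def[symmetric] M_def[symmetric] z_def[symmetric]
      by (simp only: mult_ac)
    then have "kernel_weight l \<alpha> N (x n) (w n) * phi l \<alpha> j (scaled_node l \<alpha> (x n)) =
        s * w n * (\<Sum>m=0..M. c m * ?H (2 * m) n) * (b * ?H j n)"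
      by (simp flip: exp_add)
    then show ?thesis
      by (simp add: sum_distrib_left sum_distrib_right mult_ac)
  qed
  have "(\<Sum>n=1..N. kernel_weight l \<alpha> N (x n) (w n) * phi l \<alpha> j (scaled_node l \<alpha> (x n))) =
      (\<Sum>m=0..M. b * s * c m * (\<Sum>n=1..N. w n * (?H (2 * m) n * ?H j n)))"
    unfolding term_eq by (subst sum.swap) (simp add: sum_distrib_left)
  \<comment> \<open>The truncation at \<open>M\<close> ensures \<open>2 * m < N\<close>, as discrete
    orthogonality requires; conversely, every even \<open>j < N\<close> is still reached by some
    \<open>m\<close> up to \<open>M\<close>.\<close>
  also have "\<dots> = (\<Sum>m=0..M. b * s * c m * (if 2 * m = j then fact j else 0))"
    using assms(3)
    by (intro sum.cong refl) (subst gauss_hermite_rule_hermite[OF assms(2)], auto simp: M_def)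
  also have "\<dots> = b * (s * gauss_expect (hermite_poly j \<circ>\<^sub>p [:0, sqrt 2 * \<alpha> * beta l \<alpha> * s:]))"
  proof (cases "even j")
    case True
    then obtain i where i: "j = 2 * i" by blast
    then have "i \<in> {0..M}" using assms(3) by (auto simp: M_def)
    then have "(\<Sum>m=0..M. b * s * c m * (if 2 * m = j then fact j else 0)) = b * s * c i * fact j"
      by (subst sum.remove[of _ i]) (auto simp: i)
    then show ?thesis
      unfolding i gauss_expect_scaled_hermite s2 by (simp add: c_def mult_ac)
  next
    case False
    then obtain i where i: "j = 2 * i + 1" by (auto elim: oddE)
    have "(\<Sum>m=0..M. b * s * c m * (if 2 * m = j then fact j else 0)) = 0"
      using False by (intro sum.neutral) auto
    then show ?thesis
      unfolding i gauss_expect_scaled_hermite by simp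
  qed
  also have "\<dots> = (\<integral>t. phi l \<alpha> j t \<partial>std_gaussian)"
    unfolding b_def s_def
    by (rule has_bochner_integral_integral_eq[OF has_bochner_integral_phi, symmetric])
  finally show ?thesis .
qed

section \<open>Interpolation at the nodes\<close>

lemma lagrange_poly:
  fixes x :: "nat \<Rightarrow> real"
  assumes "inj_on x A" "finite A" "k \<in> A"
  shows "\<exists>p. degree p < card A \<and> (\<forall>n\<in>A. poly p (x n) = (if n = k then 1 else 0))"
proof -
  define q where "q = (\<Prod>m\<in>A - {k}. [:- x m, 1:])"
  have q0: "poly q (x n) = 0 \<longleftrightarrow> n \<noteq> k" if "n \<in> A" for n
    using assms that by (auto simp: q_def poly_prod inj_on_def)
  have "degree q \<le> (\<Sum>m\<in>A - {k}. degree [:- x m, 1:])"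
    unfolding q_def using assms degree_prod_sum_le[of "A - {k}" "\<lambda>m. [:- x m, 1:]"]
    by (simp add: comp_def)
  also have "\<dots> < card A"
    using assms by (simp add: card_Diff_singleton) (metis card_gt_0_iff diff_less empty_iff zero_less_Suc)
  finally have "degree q < card A" .
  then show ?thesis
    using q0 assms(3) by (intro exI[of _ "smult (1 / poly q (x k)) q"]) auto
qed

text \<open>Lagrange interpolation shows that the evaluations at the nodes of the functions
  \<open>\<phi>\<^sub>0, \<dots>, \<phi>\<^bsub>N-1\<^esub>\<close> form an invertible matrix.\<close>

lemma phi_dual_basis:
  assumes "\<alpha> > 0" "gauss_hermite_rule N x w" "k \<in> {1..N}"
  shows "\<exists>b. \<forall>n\<in>{1..N}. (\<Sum>j<N. b j * phi l \<alpha> j (scaled_node l \<alpha> (x n))) = (if n = k then 1 else 0)"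
proof -
  have "inj_on x {1..N}"
    using assms(2) by (simp add: gauss_hermite_rule_def)
  from lagrange_poly[OF this _ assms(3)] obtain p
    where p: "degree p < N" "\<forall>n\<in>{1..N}. poly p (x n) = (if n = k then 1 else 0)"
    by auto
  obtain c where c: "p = (\<Sum>j<N. smult (c j) (hermite_poly j))"
    using hermite_poly_basis[OF p(1)] by blast
  define e where "e n = exp (- delta_sq l \<alpha> * (scaled_node l \<alpha> (x n))\<^sup>2)" for n
  define r where "r j = sqrt (beta l \<alpha> / fact j)" for j
  have r: "r j \<noteq> 0" for j
    using beta_ge_1[of l \<alpha>] by (simp add: r_def)
  \<comment> \<open>Dividing by \<open>r j\<close> removes the normalisation of \<open>phi\<close>.
    The exponential leaves \<open>e n / e k\<close>, which is 1 at \<open>n = k\<close> and harmless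
    elsewhere because \<open>p\<close> vanishes there.\<close>
  have "(\<Sum>j<N. c j / (e k * r j) * phi l \<alpha> j (scaled_node l \<alpha> (x n))) = e n / e k * poly p (x n)" for n
    unfolding phi_scaled_node[OF assms(1)] c poly_sum sum_distrib_left
      e_def[symmetric] r_def[symmetric]
    using r by (intro sum.cong refl) (simp add: field_simps)
  then have "\<forall>n\<in>{1..N}. (\<Sum>j<N. c j / (e k * r j) * phi l \<alpha> j (scaled_node l \<alpha> (x n))) =
      (if n = k then 1 else 0)"
    using p(2) by (simp add: e_def)
  then show ?thesis
    by (rule exI[where x = "\<lambda>j. c j / (e k * r j)"])
qed


section \<open>Tensor products\<close>

text \<open>Lebesgue measure is the image of a product measure indexed by \<open>Basis\<close>; the
  bijection \<open>ax\<close> from coordinates to basis vectors reduces the claim to Fubini for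
  finite products.\<close>

lemma lborel_integral_prod_vec:
  fixes f :: "'d::finite \<Rightarrow> real \<Rightarrow> real"
  assumes "\<And>i. integrable lborel (f i)"
  shows "(\<integral>t. (\<Prod>i\<in>UNIV. f i (t $ i)) \<partial>(lborel :: (real ^ 'd) measure)) =
           (\<Prod>i\<in>UNIV. \<integral>t. f i t \<partial>lborel)"
proof -
  interpret product_sigma_finite "\<lambda>_ :: real ^ 'd. lborel :: real measure" ..
  define ax :: "'d \<Rightarrow> real ^ 'd" where "ax i = axis i 1" for i
  have inj: "inj ax"
    by (auto simp: inj_def ax_def axis_eq_axis)
  have Basis: "(Basis :: (real ^ 'd) set) = range ax"
    by (auto simp: Basis_vec_def ax_def)
  have [measurable]: "f i \<in> borel_measurable borel" for i
    using assms[of i] by auto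
  have component: "(\<Sum>b\<in>Basis. y b * b $ i) = y (ax i)" for y :: "real ^ 'd \<Rightarrow> real" and i
    by (simp add: Basis sum.reindex[OF inj])
       (simp add: ax_def axis_def if_distrib cong: if_cong)
  have "(\<integral>t. (\<Prod>i\<in>UNIV. f i (t $ i)) \<partial>(lborel :: (real ^ 'd) measure)) =
      (\<integral>y. (\<Prod>i\<in>UNIV. f i (y (ax i))) \<partial>(\<Pi>\<^sub>M b\<in>Basis. lborel))"
    by (subst lborel_eq, subst integral_distr) (simp_all add: component)
  also have "\<dots> = (\<integral>y. (\<Prod>b\<in>Basis. f (inv ax b) (y b)) \<partial>(\<Pi>\<^sub>M b\<in>Basis. lborel))"
    by (simp add: Basis prod.reindex[OF inj] inv_f_f[OF inj])
  also have "\<dots> = (\<Prod>b\<in>Basis. \<integral>t. f (inv ax b) t \<partial>lborel)"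
    by (rule product_integral_prod) (auto intro: assms)
  also have "\<dots> = (\<Prod>i\<in>UNIV. \<integral>t. f i t \<partial>lborel)"
    by (simp add: Basis prod.reindex[OF inj] inv_f_f[OF inj])
  finally show ?thesis .
qed

lemma std_gaussian_vec_density:
  fixes t :: "real ^ 'd::finite"
  shows "(2 * pi) powr (- (real DIM(real ^ 'd) / 2)) * exp (- (norm t)\<^sup>2 / 2) =
    (\<Prod>i\<in>UNIV. std_normal_density (t $ i))"
proof -
  have "(norm t)\<^sup>2 = (\<Sum>i\<in>UNIV. (t $ i)\<^sup>2)"
    by (simp add: norm_vec_def L2_set_def sum_nonneg)
  then have "exp (- (norm t)\<^sup>2 / 2) = (\<Prod>i\<in>UNIV. exp (- (t $ i)\<^sup>2 / 2))"
    by (simp add: exp_sum[symmetric] sum_divide_distrib sum_negf)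
  moreover have "(2 * pi) powr (- (real DIM(real ^ 'd) / 2)) = (1 / sqrt (2 * pi)) ^ CARD('d)"
  proof -
    have "1 / sqrt (2 * pi) = (2 * pi) powr (- (1 / 2))"
      by (simp add: powr_minus_divide powr_half_sqrt)
    then have "(1 / sqrt (2 * pi)) ^ CARD('d) = ((2 * pi) powr (- (1 / 2))) powr real CARD('d)"
      by (simp add: powr_realpow)
    then show ?thesis
      by (simp add: powr_powr)
  qed
  ultimately show ?thesis
    by (simp add: std_normal_density_def prod_dividef power_one_over)
qed

lemma std_gaussian_integral_prod_vec:
  fixes f :: "'d::finite \<Rightarrow> real \<Rightarrow> real"
  assumes "\<And>i. integrable std_gaussian (f i)"
  shows "(\<integral>t. (\<Prod>i\<in>UNIV. f i (t $ i)) \<partial>(std_gaussian :: (real ^ 'd) measure)) =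
           (\<Prod>i\<in>UNIV. \<integral>t. f i t \<partial>std_gaussian)"
proof -
  have [measurable]: "f i \<in> borel_measurable borel" for i
    using assms[of i] by (auto simp: std_gaussian_real)
  have int: "integrable lborel (\<lambda>t. std_normal_density t * f i t)" for i
    using assms[of i] unfolding std_gaussian_real by (subst (asm) integrable_density) auto
  have "(\<integral>t. (\<Prod>i\<in>UNIV. f i (t $ i)) \<partial>(std_gaussian :: (real ^ 'd) measure)) =
      (\<integral>t. (\<Prod>i\<in>UNIV. std_normal_density (t $ i) * f i (t $ i)) \<partial>(lborel :: (real ^ 'd) measure))"
    unfolding std_gaussian_def std_gaussian_vec_density
    by (subst integral_density) (auto simp: prod_nonneg prod.distrib)
  also have "\<dots> = (\<Prod>i\<in>UNIV. \<integral>t. std_normal_density t * f i t \<partial>lborel)"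
    by (rule lborel_integral_prod_vec[OF int])
  also have "\<dots> = (\<Prod>i\<in>UNIV. \<integral>t. f i t \<partial>std_gaussian)"
    unfolding std_gaussian_real by (subst integral_density) auto
  finally show ?thesis .
qed

section \<open>Existence and uniqueness of the tensor product weights\<close>

lemma node_indices_eq_PiE: "node_indices N = PiE UNIV (\<lambda>i. {1..N i})"
  by (auto simp: node_indices_def PiE_def Pi_def)

text \<open>An equivalence captures weights defined by exactness: one direction is uniqueness, the
  other says that the product weights solve the conditions.\<close>

theorem theorem4p1:
  fixes l \<alpha> :: "'d::finite \<Rightarrow> real"
    and N :: "'d \<Rightarrow> nat"
    and x w :: "'d \<Rightarrow> nat \<Rightarrow> real"
    and W :: "('d \<Rightarrow> nat) \<Rightarrow> real"
  assumes "\<And>i. l i > 0"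
    and "\<And>i. \<alpha> i > 0"
    and "\<And>i. N i \<ge> 1"
    and "\<And>i. gauss_hermite_rule (N i) (x i) (w i)"
  shows "(\<forall>J. (\<forall>i. J i \<le> N i - 1) \<longrightarrow>
            tensor_rule l \<alpha> N x W (phi_multi l \<alpha> J) =
              (\<integral>t. phi_multi l \<alpha> J t \<partial>std_gaussian))
         \<longleftrightarrow>
         (\<forall>I\<in>node_indices N.
            W I = (\<Prod>i\<in>UNIV. kernel_weight (l i) (\<alpha> i) (N i) (x i (I i)) (w i (I i))))"
proof -
  define V where "V I = (\<Prod>i\<in>UNIV. kernel_weight (l i) (\<alpha> i) (N i) (x i (I i)) (w i (I i)))" for I
  define f where "f i j n = phi (l i) (\<alpha> i) j (scaled_node (l i) (\<alpha> i) (x i n))" for i j n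
  \<comment> \<open>Subtraction truncates, so \<open>N i \<ge> 1\<close> matters: with
    \<open>N i = 0\<close> the left side would admit \<open>J i = 0\<close>.\<close>
  have bound: "(\<forall>i. J i \<le> N i - 1) \<longleftrightarrow> (\<forall>i. J i < N i)" for J
  proof -
    have "J i \<le> N i - 1 \<longleftrightarrow> J i < N i" for i
      using assms(3)[of i] by linarith
    then show ?thesis by simp
  qed
  have rule: "tensor_rule l \<alpha> N x U (phi_multi l \<alpha> J) =
      (\<Sum>I\<in>node_indices N. U I * (\<Prod>i\<in>UNIV. f i (J i) (I i)))" for U J
    by (simp add: tensor_rule_def phi_multi_def tensor_node_def f_def)
  have exact: "tensor_rule l \<alpha> N x V (phi_multi l \<alpha> J) = (\<integral>t. phi_multi l \<alpha> J t \<partial>std_gaussian)"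
    if J: "\<And>i. J i < N i" for J
  proof -
    have "tensor_rule l \<alpha> N x V (phi_multi l \<alpha> J) =
        (\<Prod>i\<in>UNIV. \<Sum>n=1..N i. kernel_weight (l i) (\<alpha> i) (N i) (x i n) (w i n) * f i (J i) n)"
      unfolding rule V_def node_indices_eq_PiE by (subst prod_sum_PiE) (auto simp: prod.distrib)
    also have "\<dots> = (\<Prod>i\<in>UNIV. \<integral>t. phi (l i) (\<alpha> i) (J i) t \<partial>std_gaussian)"
      unfolding f_def by (intro prod.cong refl kernel_weight_exact assms J)
    also have "\<dots> = (\<integral>t. phi_multi l \<alpha> J t \<partial>std_gaussian)"
      unfolding phi_multi_def
      by (rule std_gaussian_integral_prod_vec[symmetric])
         (rule integrable.intros[OF has_bochner_integral_phi])
    finally show ?thesis .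
  qed
  have unique: "W K = V K"
    if W: "\<And>J. (\<And>i. J i < N i) \<Longrightarrow>
        tensor_rule l \<alpha> N x W (phi_multi l \<alpha> J) = tensor_rule l \<alpha> N x V (phi_multi l \<alpha> J)"
      and K: "K \<in> node_indices N" for K
  proof -
    have "\<forall>i. \<exists>b. \<forall>n\<in>{1..N i}. (\<Sum>j<N i. b j * f i j n) = (if n = K i then 1 else 0)"
      unfolding f_def using K
      by (intro allI phi_dual_basis[OF assms(2) assms(4)]) (auto simp: node_indices_def)
    then obtain b where b: "\<And>i n. n \<in> {1..N i} \<Longrightarrow>
        (\<Sum>j<N i. b i j * f i j n) = (if n = K i then 1 else 0)"
      by metis
    \<comment> \<open>Function indices run from 0 to \<open>N i - 1\<close>, node indices from 1 to
      \<open>N i\<close>.\<close>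
    define P where "P = PiE UNIV (\<lambda>i. {..<N i})"
    have indicator: "(\<Sum>J\<in>P. (\<Prod>i\<in>UNIV. b i (J i)) * (\<Prod>i\<in>UNIV. f i (J i) (I i))) =
        (if I = K then 1 else 0)" if I: "I \<in> node_indices N" for I
    proof -
      have "(\<Sum>J\<in>P. (\<Prod>i\<in>UNIV. b i (J i)) * (\<Prod>i\<in>UNIV. f i (J i) (I i))) =
          (\<Prod>i\<in>UNIV. \<Sum>j<N i. b i j * f i j (I i))"
        unfolding P_def by (subst prod_sum_PiE) (auto simp: prod.distrib)
      also have "\<dots> = (\<Prod>i\<in>UNIV. if I i = K i then 1 else 0)"
        using I by (intro prod.cong refl b) (auto simp: node_indices_def)
      also have "\<dots> = (if I = K then 1 else 0)"
        by (auto simp: fun_eq_iff)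
      finally show ?thesis .
    qed
    \<comment> \<open>The combination of basis functions that is 1 at node \<open>K\<close> and 0 at
      the others extracts a single weight. Since \<open>U\<close> is arbitrary, this applies to
      \<open>W\<close> and \<open>V\<close> alike.\<close>
    have pick: "(\<Sum>J\<in>P. (\<Prod>i\<in>UNIV. b i (J i)) * tensor_rule l \<alpha> N x U (phi_multi l \<alpha> J)) = U K"
      for U
    proof -
      have "(\<Sum>J\<in>P. (\<Prod>i\<in>UNIV. b i (J i)) * tensor_rule l \<alpha> N x U (phi_multi l \<alpha> J)) =
          (\<Sum>I\<in>node_indices N. U I *
            (\<Sum>J\<in>P. (\<Prod>i\<in>UNIV. b i (J i)) * (\<Prod>i\<in>UNIV. f i (J i) (I i))))"
        unfolding rule sum_distrib_left by (subst sum.swap) (simp add: mult_ac)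
      also have "\<dots> = (\<Sum>I\<in>node_indices N. U I * (if I = K then 1 else 0))"
        by (intro sum.cong refl) (simp only: indicator)
      also have "\<dots> = U K"
        using K by (simp add: if_distrib node_indices_eq_PiE finite_PiE cong: if_cong)
      finally show ?thesis .
    qed
    have "(\<Sum>J\<in>P. (\<Prod>i\<in>UNIV. b i (J i)) * tensor_rule l \<alpha> N x W (phi_multi l \<alpha> J)) =
        (\<Sum>J\<in>P. (\<Prod>i\<in>UNIV. b i (J i)) * tensor_rule l \<alpha> N x V (phi_multi l \<alpha> J))"
      by (intro sum.cong refl arg_cong2[where f = "(*)"] W) (auto simp: P_def)
    then show ?thesis
      by (simp only: pick)
  qed
  show ?thesis
    unfolding V_def[symmetric] bound
  proof
    assume "\<forall>J. (\<forall>i. J i < N i) \<longrightarrow> tensor_rule l \<alpha> N x W (phi_multi l \<alpha> J) =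
        (\<integral>t. phi_multi l \<alpha> J t \<partial>std_gaussian)"
    then show "\<forall>I\<in>node_indices N. W I = V I"
      using exact unique by simp
  next
    assume "\<forall>I\<in>node_indices N. W I = V I"
    then have "tensor_rule l \<alpha> N x W g = tensor_rule l \<alpha> N x V g" for g
      by (simp add: tensor_rule_def)
    then show "\<forall>J. (\<forall>i. J i < N i) \<longrightarrow> tensor_rule l \<alpha> N x W (phi_multi l \<alpha> J) =
        (\<integral>t. phi_multi l \<alpha> J t \<partial>std_gaussian)"
      using exact by simp
  qed
qed

end
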